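(* Let $A\in\mathbb{C}^{n\times n}$ be Hermitian and $B\in\mathbb{C}^{n\times n}$ Hermitian positive definite. Let $a<b$ be real, $\gamma=(a+b)/2$, $\rho=(b-a)/2$, let $N$ be a positive integer, and let $z_j=\gamma+\rho\,\mathrm{e}^{\mathrm{i}\theta_j}$ with $\theta_j=\frac{2j-1}{N}\pi$, $j=1,2,\dots,N$. Let $j \in \{1,\dots,N\}$ with $\operatorname{Im} z_j\ne 0$, let $\boldsymbol{b}\in\mathbb{C}^n$, let $\boldsymbol{y}^\ast=(z_jB-A)^{-1}\boldsymbol{b}$ be the solution of $(z_jB-A)\boldsymbol{y}=\boldsymbol{b}$, and let $\tilde{\boldsymbol{y}}\in\mathbb{C}^n$ be an (arbitrary) approximate solution, with residual $\tilde{\boldsymbol{r}}=\boldsymbol{b}-(z_jB-A)\tilde{\boldsymbol{y}}$. Denote the $i$th entries of $\boldsymbol{y}^\ast$ and $\tilde{\boldsymbol{y}}$ by $y_i^\ast$ and $\tilde y_i$, respectively. Then $$|\tilde y_i-y_i^\ast|\le |\operatorname{Im} z_j|^{-1}\,\lambda_{\min}(B)^{-1}\,\|\tilde{\boldsymbol{r}}\|_2\qquad\text{for all } i=1,2,\dots,n,$$ where $\lambda_{\min}(B)$ is the smallest eigenvalue of $B$ and $\|\cdot\|_2$ is the Euclidean norm. *)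

theory Defs
  imports "HOL-Analysis.Analysis"
begin

definition mat_scale :: "complex \<Rightarrow> complex^'n^'m \<Rightarrow> complex^'n^'m" (infixl "*k" 70) where
  "c *k A = (\<chi> i j. c * A $ i $ j)"

definition conj_transpose :: "complex^'n^'m \<Rightarrow> complex^'m^'n" where
  "conj_transpose A = (\<chi> i j. cnj (A $ j $ i))"

definition hermitian :: "complex^'n^'n \<Rightarrow> bool" where
  "hermitian A \<longleftrightarrow> conj_transpose A = A"

(* The form x^H A x, i.e. the standard sesquilinear product of x and A x. *)
definition hermitian_form :: "complex^'n^'n \<Rightarrow> complex^'n \<Rightarrow> complex" where
  "hermitian_form A x = (\<Sum>i\<in>UNIV. cnj (x $ i) * (A *v x) $ i)"

(* For Hermitian A the form is real-valued, so Re only converts the type. *)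
definition hermitian_positive_definite :: "complex^'n^'n \<Rightarrow> bool" where
  "hermitian_positive_definite A \<longleftrightarrow>
     hermitian A \<and> (\<forall>x. x \<noteq> 0 \<longrightarrow> 0 < Re (hermitian_form A x))"

definition eigenvalue :: "complex^'n^'n \<Rightarrow> complex \<Rightarrow> bool" where
  "eigenvalue A \<mu> \<longleftrightarrow> (\<exists>v. v \<noteq> 0 \<and> A *v v = \<mu> *s v)"

(* Only meaningful for Hermitian A, where all eigenvalues are real and a least one exists. *)
definition lambda_min :: "complex^'n^'n \<Rightarrow> real" where
  "lambda_min A = (LEAST x. eigenvalue A (complex_of_real x))"

end

theory Submission
  imports Defs
begin

text \<open>
  Write \<open>C = z B - A\<close>. As \<open>A\<close> and \<open>B\<close> are Hermitian, the imaginary part of \<open>x\<^sup>H C x\<close> is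
  \<open>Im z\<close> times \<open>x\<^sup>H B x\<close>, so Cauchy-Schwarz and the Rayleigh bound
  \<open>\<lambda>\<^sub>m\<^sub>i\<^sub>n(B) \<parallel>x\<parallel>\<^sup>2 \<le> x\<^sup>H B x\<close> give \<open>\<bar>Im z\<bar> \<lambda>\<^sub>m\<^sub>i\<^sub>n(B) \<parallel>x\<parallel> \<le> \<parallel>C x\<parallel>\<close>. This is applied to the error
  \<open>x = y - y\<^sup>*\<close>, for which \<open>C x\<close> is minus the residual.

  All products are taken with the real inner product \<open>x \<bullet> y = Re (x\<^sup>H y)\<close> of \<open>complex^'n\<close>;
  the imaginary part of \<open>x\<^sup>H y\<close> is then \<open>(\<i> *s x) \<bullet> y\<close>.
\<close>

lemma inner_scalar_i_scalar_i: "(\<i> *s x) \<bullet> (\<i> *s y) = x \<bullet> (y :: complex^'n)"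
  by (simp add: inner_vec_def inner_complex_def add.commute)

lemma inner_scalar_i_left: "(\<i> *s x) \<bullet> y = - (x \<bullet> (\<i> *s (y :: complex^'n)))"
  by (simp add: inner_vec_def inner_complex_def flip: sum_negf)

lemma norm_scalar_i: "norm (\<i> *s x) = norm (x :: complex^'n)"
  by (simp add: norm_eq_sqrt_inner inner_scalar_i_scalar_i)

lemma complex_scalar_decompose:
  "c *s x = Re c *\<^sub>R x + Im c *\<^sub>R (\<i> *s (x :: complex^'n))"
  by (simp add: vec_eq_iff complex_eq_iff)

lemma of_real_scalar: "complex_of_real c *s x = c *\<^sub>R (x :: complex^'n)"
  by (simp add: vec_eq_iff complex_eq_iff)

lemma Re_hermitian_form: "Re (hermitian_form A x) = x \<bullet> (A *v x)"
  by (simp add: hermitian_form_def inner_vec_def inner_complex_def)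

lemma mat_scale_mult_vec: "(c *k A) *v x = c *s (A *v x)"
  by (simp add: vec_eq_iff mat_scale_def matrix_vector_mult_def sum_distrib_left mult.assoc)

lemma hermitian_inner:
  assumes "hermitian (A :: complex^'n^'n)"
  shows "(A *v x) \<bullet> y = x \<bullet> (A *v y)"
proof -
  have A: "cnj (A $ i $ j) = A $ j $ i" for i j
  proof -
    have "conj_transpose A $ j $ i = A $ j $ i"
      using assms by (simp add: hermitian_def)
    then show ?thesis
      by (simp add: conj_transpose_def)
  qed
  have ip: "u \<bullet> v = Re (\<Sum>i\<in>UNIV. cnj (u $ i) * v $ i)" for u v :: "complex^'n"
    by (simp add: inner_vec_def inner_complex_def)
  have "(\<Sum>i\<in>UNIV. cnj ((A *v x) $ i) * y $ i)
      = (\<Sum>i\<in>UNIV. \<Sum>j\<in>UNIV. A $ j $ i * cnj (x $ j) * y $ i)"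
    by (simp add: matrix_vector_mult_def A sum_distrib_right)
  also have "\<dots> = (\<Sum>j\<in>UNIV. \<Sum>i\<in>UNIV. A $ j $ i * cnj (x $ j) * y $ i)"
    by (rule sum.swap)
  also have "\<dots> = (\<Sum>j\<in>UNIV. cnj (x $ j) * (A *v y) $ j)"
    by (simp add: matrix_vector_mult_def sum_distrib_left mult_ac)
  finally show ?thesis
    by (simp add: ip)
qed

text \<open>First-order condition for a minimum at \<open>t = 0\<close>: a nonzero linear term would
  dominate for small \<open>t\<close> of the sign opposite to \<open>p\<close>.\<close>

lemma nonneg_quadratic_linear_coeff_zero:
  fixes p q :: real
  assumes "\<And>t. 0 \<le> t * p + t\<^sup>2 * q"
  shows "p = 0"
proof (rule ccontr)
  assume "p \<noteq> 0"
  \<comment> \<open>Any positive \<open>s\<close> above \<open>q\<close> serves: at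
    \<open>t = - p / s\<close> the quadratic has the sign of \<open>q - s\<close>.\<close>
  define s where "s = \<bar>q\<bar> + 1"
  have s: "s > 0" "q < s" by (auto simp: s_def)
  have "(- p / s) * p + (- p / s)\<^sup>2 * q = p\<^sup>2 * (q - s) / s\<^sup>2"
    using s by (simp add: field_simps power2_eq_square)
  also have "\<dots> < 0"
    using s \<open>p \<noteq> 0\<close> by (simp add: divide_less_0_iff mult_less_0_iff)
  finally show False
    using assms[of "- p / s"] by simp
qed

text \<open>The Rayleigh quotient attains its minimum on the compact unit sphere, and vanishing of
  the first variation makes the minimiser an eigenvector.\<close>

lemma self_adjoint_min_eigenvector:
  fixes f :: "'a::euclidean_space \<Rightarrow> 'a"
  assumes lin: "linear f" and adj: "\<And>x y. f x \<bullet> y = x \<bullet> f y"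
  obtains m v where "norm v = 1" "f v = m *\<^sub>R v" "\<And>x. m * (norm x)\<^sup>2 \<le> x \<bullet> f x"
proof -
  have "continuous_on (sphere 0 1) (\<lambda>x. x \<bullet> f x)"
    by (intro continuous_intros linear_continuous_on linear_conv_bounded_linear[THEN iffD1] lin)
  moreover have "sphere (0::'a) 1 \<noteq> {}"
    by simp
  ultimately obtain v where v: "norm v = 1" and min: "\<And>x. norm x = 1 \<Longrightarrow> v \<bullet> f v \<le> x \<bullet> f x"
    using continuous_attains_inf[OF compact_sphere, of 0 1 "\<lambda>x. x \<bullet> f x"] by force
  define m where "m = v \<bullet> f v"
  have bound: "m * (norm x)\<^sup>2 \<le> x \<bullet> f x" for x
  proof (cases "x = 0")
    case False
    have "m \<le> (x /\<^sub>R norm x) \<bullet> f (x /\<^sub>R norm x)"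
      unfolding m_def using False by (intro min) simp
    also have "\<dots> = (x \<bullet> f x) / (norm x)\<^sup>2"
      by (simp add: linear_scale[OF lin] field_simps power2_eq_square)
    finally show ?thesis
      using False by (simp add: field_simps)
  qed (simp add: linear_0[OF lin])
  \<comment> \<open>The defect of the eigenvector equation is itself the direction of variation: the
    linear coefficient becomes \<open>2 * (w \<bullet> w)\<close>, which is zero only if
    \<open>w = 0\<close>.\<close>
  define w where "w = f v - m *\<^sub>R v"
  have "0 \<le> t * (2 * (w \<bullet> w)) + t\<^sup>2 * (w \<bullet> f w - m * (w \<bullet> w))" for t
  proof -
    have vv: "v \<bullet> v = 1"
      using v by (simp add: norm_eq_1)
    have ww: "w \<bullet> f v = w \<bullet> w + m * (w \<bullet> v)"
      by (simp add: w_def algebra_simps inner_commute)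
    have "0 \<le> (v + t *\<^sub>R w) \<bullet> f (v + t *\<^sub>R w) - m * (norm (v + t *\<^sub>R w))\<^sup>2"
      using bound by simp
    also have "\<dots> = 2 * t * (w \<bullet> f v - m * (w \<bullet> v)) + t\<^sup>2 * (w \<bullet> f w - m * (w \<bullet> w))"
      using vv adj[of v w] unfolding power2_norm_eq_inner
      by (simp add: linear_add[OF lin] linear_scale[OF lin] inner_commute m_def
          algebra_simps power2_eq_square)
    finally show ?thesis
      by (simp add: ww algebra_simps)
  qed
  from nonneg_quadratic_linear_coeff_zero[OF this] have "f v = m *\<^sub>R v"
    by (simp add: w_def)
  with v bound that show ?thesis
    by blast
qed

text \<open>The minimum \<open>m\<close> of the Rayleigh quotient is an eigenvalue, and its bound at
  an eigenvector for a real eigenvalue \<open>c\<close> gives \<open>m \<le> c\<close>. Hence the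
  \<open>LEAST\<close> in \<open>lambda_min\<close> is attained and equals \<open>m\<close>.\<close>

lemma hermitian_lambda_min:
  fixes A :: "complex^'n^'n"
  assumes "hermitian A"
  shows eigenvalue_lambda_min: "eigenvalue A (complex_of_real (lambda_min A))"
    and lambda_min_le_inner: "lambda_min A * (norm x)\<^sup>2 \<le> x \<bullet> (A *v x)"
proof -
  obtain m v where v: "norm v = 1" "A *v v = m *\<^sub>R v"
    and bound: "\<And>x. m * (norm x)\<^sup>2 \<le> x \<bullet> (A *v x)"
    using self_adjoint_min_eigenvector[of "(*v) A"] hermitian_inner[OF assms]
    by (metis matrix_vector_mul_linear)
  have ev: "eigenvalue A (complex_of_real m)"
    unfolding eigenvalue_def of_real_scalar using v by (intro exI[of _ v]) auto
  have "m \<le> c" if c: "eigenvalue A (complex_of_real c)" for c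
  proof -
    obtain u where u: "u \<noteq> 0" "A *v u = c *\<^sub>R u"
      using c by (auto simp: eigenvalue_def of_real_scalar)
    then show ?thesis
      using bound[of u] by (simp add: power2_norm_eq_inner)
  qed
  with ev have "lambda_min A = m"
    unfolding lambda_min_def by (intro Least_equality)
  with ev bound show "eigenvalue A (complex_of_real (lambda_min A))"
    and "lambda_min A * (norm x)\<^sup>2 \<le> x \<bullet> (A *v x)"
    by simp_all
qed

lemma lambda_min_pos:
  fixes B :: "complex^'n^'n"
  assumes "hermitian_positive_definite B"
  shows "0 < lambda_min B"
proof -
  have "hermitian B"
    using assms by (simp add: hermitian_positive_definite_def)
  from eigenvalue_lambda_min[OF this] obtain v
    where "v \<noteq> 0" and v: "B *v v = lambda_min B *\<^sub>R v"
    by (auto simp: eigenvalue_def of_real_scalar)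
  then have "0 < v \<bullet> (B *v v)"
    using assms by (metis hermitian_positive_definite_def Re_hermitian_form)
  then show ?thesis
    by (simp add: v zero_less_mult_iff not_less[THEN iffD2, OF inner_ge_zero])
qed

text \<open>The left side is the imaginary part of the Hermitian form; moving \<open>A\<close> and
  then \<open>\<i>\<close> across the inner product shows that it equals its own negative.\<close>

lemma hermitian_inner_scalar_i:
  fixes A :: "complex^'n^'n"
  assumes "hermitian A"
  shows "(\<i> *s x) \<bullet> (A *v x) = 0"
proof -
  have "(\<i> *s x) \<bullet> (A *v x) = (\<i> *s (A *v x)) \<bullet> x"
    by (metis hermitian_inner[OF assms] vector_scalar_commute)
  also have "\<dots> = - ((\<i> *s x) \<bullet> (A *v x))"
    by (metis inner_commute inner_scalar_i_left)
  finally show ?thesis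
    by simp
qed

lemma norm_pencil_ge:
  fixes A B :: "complex^'n^'n"
  assumes A: "hermitian A" and B: "hermitian B"
  shows "\<bar>Im c\<bar> * lambda_min B * norm x \<le> norm ((c *k B - A) *v x)"
proof (cases "x = 0")
  case False
  \<comment> \<open>Pairing with \<open>\<i> *s x\<close> kills the terms from \<open>A\<close> and
    from \<open>Re c\<close>, leaving only the one from \<open>Im c\<close>.\<close>
  have "(\<i> *s x) \<bullet> ((c *k B - A) *v x) = Im c * (x \<bullet> (B *v x))"
    by (simp add: matrix_vector_mult_diff_rdistrib mat_scale_mult_vec
        complex_scalar_decompose[of c] inner_diff_right inner_add_right
        hermitian_inner_scalar_i[OF A] hermitian_inner_scalar_i[OF B] inner_scalar_i_scalar_i)
  then have "\<bar>Im c * (x \<bullet> (B *v x))\<bar> \<le> norm x * norm ((c *k B - A) *v x)"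
    by (metis Cauchy_Schwarz_ineq2 norm_scalar_i)
  moreover have "\<bar>Im c\<bar> * (lambda_min B * (norm x)\<^sup>2) \<le> \<bar>Im c\<bar> * \<bar>x \<bullet> (B *v x)\<bar>"
    using lambda_min_le_inner[OF B, of x] by (intro mult_left_mono) auto
  ultimately have "norm x * (\<bar>Im c\<bar> * lambda_min B * norm x)
      \<le> norm x * norm ((c *k B - A) *v x)"
    by (simp add: abs_mult power2_eq_square mult_ac)
  then show ?thesis
    using False by simp
qed simp

theorem theorem4p1:
  fixes A B :: "complex^'n^'n"
    and a b \<gamma> \<rho> :: real
    and N j :: nat
    and \<theta> :: "nat \<Rightarrow> real"
    and z :: "nat \<Rightarrow> complex"
    and bb ystar ytilde rtilde :: "complex^'n"
  assumes A_herm: "hermitian A"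
    and B_hpd: "hermitian_positive_definite B"
    and ab: "a < b"
    and gamma: "\<gamma> = (a + b) / 2"
    and rho: "\<rho> = (b - a) / 2"
    and N_pos: "N > 0"
    and theta: "\<And>k. k \<in> {1..N} \<Longrightarrow> \<theta> k = (2 * real k - 1) / real N * pi"
    and z: "\<And>k. k \<in> {1..N} \<Longrightarrow>
              z k = complex_of_real \<gamma> + complex_of_real \<rho> * exp (\<i> * complex_of_real (\<theta> k))"
    and j: "j \<in> {1..N}"
    and Im_z: "Im (z j) \<noteq> 0"
    and ystar: "ystar = matrix_inv (z j *k B - A) *v bb"
    and rtilde: "rtilde = bb - (z j *k B - A) *v ytilde"
  shows "invertible (z j *k B - A) \<and>
         (\<forall>i. cmod (ytilde $ i - ystar $ i)
                \<le> inverse \<bar>Im (z j)\<bar> * inverse (lambda_min B) * norm rtilde)"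
proof -
  let ?C = "z j *k B - A"
  have B: "hermitian B"
    using B_hpd by (simp add: hermitian_positive_definite_def)
  have pos: "0 < \<bar>Im (z j)\<bar> * lambda_min B"
    using Im_z lambda_min_pos[OF B_hpd] by simp
  have ge: "\<bar>Im (z j)\<bar> * lambda_min B * norm x \<le> norm (?C *v x)" for x
    by (rule norm_pencil_ge[OF A_herm B])
  \<comment> \<open>The lower bound with a positive constant forces a trivial kernel, which for a
    square matrix means invertibility.\<close>
  have "x = 0" if "?C *v x = 0" for x
    using ge[of x] mult_pos_pos[OF pos, of "norm x"] that by fastforce
  then have inv: "invertible ?C"
    by (simp add: invertible_left_inverse matrix_left_invertible_ker)
  \<comment> \<open>\<open>matrix_inv\<close> is a choice operator, so its defining property is
    available only once an inverse is known to exist.\<close>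
  then have "?C ** matrix_inv ?C = mat 1"
    unfolding invertible_def matrix_inv_def by (rule someI2_ex) simp
  then have "?C *v ystar = bb"
    by (simp add: ystar matrix_vector_mul_assoc)
  then have "?C *v (ytilde - ystar) = - rtilde"
    by (simp add: rtilde matrix_vector_mult_diff_distrib)
  with ge[of "ytilde - ystar"]
  have err: "\<bar>Im (z j)\<bar> * lambda_min B * norm (ytilde - ystar) \<le> norm rtilde"
    by simp
  have "cmod (ytilde $ i - ystar $ i)
      \<le> inverse \<bar>Im (z j)\<bar> * inverse (lambda_min B) * norm rtilde" for i
  proof -
    have "cmod (ytilde $ i - ystar $ i) \<le> norm (ytilde - ystar)"
      by (metis Finite_Cartesian_Product.norm_nth_le vector_minus_component)
    also have "\<dots> \<le> norm rtilde / (\<bar>Im (z j)\<bar> * lambda_min B)"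
      using err pos by (simp add: pos_le_divide_eq mult.commute)
    finally show ?thesis
      by (simp add: field_simps)
  qed
  with inv show ?thesis
    by blast
qed

end
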